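(* Let $(M,\mathcal V)$ be a Lie structure at infinity on a smooth manifold $M_0$, and let $g_1$, $g_2$ be two Riemannian metrics on $M_0$ which are both Riemannian metrics for this Lie structure at infinity (i.e. each $g_i$ is the restriction to $TM_0\cong A_{\mathcal V}|_{M_0}$ of a Riemannian metric on the vector bundle $A_{\mathcal V}\to M$). Then $g_1$ and $g_2$ are bi-Lipschitz: there is a constant $C>0$ with $$C^{-1}g_2(X,X)\le g_1(X,X)\le C\,g_2(X,X)\qquad\text{for all } X\in TM_0 .$$ In particular, $C^{-1}d_2(x,y)\le d_1(x,y)\le C\,d_2(x,y)$ for all $x,y\in M_0$, where $d_i$ is the distance function on $M_0$ associated to $g_i$.
   Context: Manifolds may have corners: they are locally modelled on $[0,\infty)^k\times\mathbb R^{n-k}$, and each hyperface (codimension one boundary face) $H$ is assumed embedded with a smooth defining function $x_H\ge 0$, $H=\{x_H=0\}$, $dx_H\ne 0$ on $H$. $\partial M$ is the union of all hyperfaces and $M\smallsetminus\partial M$ is the interior. A smooth manifold has no corners. A structural Lie algebra of vector fields on $M$ is a real subspace $\mathcal V\subset\Gamma(TM)$ that (i) is closed under Lie brackets, (ii) is closed under multiplication by $C^\infty(M)$ and is a finitely generated projective $C^\infty(M)$-module, (iii) consists of vector fields tangent to all faces of $M$. By the Serre–Swan theorem there is a vector bundle $A=A_{\mathcal V}\to M$ with $\mathcal V\cong\Gamma(A)$ as $C^\infty(M)$-modules (fiber $A_x=\mathcal V/\mathfrak p_x\mathcal V$, $\mathfrak p_x$ the ideal of functions vanishing at $x$), and a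 bundle map $\varrho:A\to TM$ (the anchor) inducing on sections the inclusion $\mathcal V\subset\Gamma(TM)$. A Lie structure at infinity on a smooth manifold $M_0$ is a pair $(M,\mathcal V)$ where $M$ is a compact manifold, possibly with corners, with interior $M_0$, $\mathcal V$ is a structural Lie algebra of vector fields on $M$, and $\varrho|_{M_0}:A|_{M_0}\to TM_0$ is a fiberwise isomorphism. A Riemannian metric on $A$ is a smooth positive definite symmetric 2-tensor on $A$ (over all of $M$); via $\varrho$ it induces a Riemannian metric on $M_0$. *)

theory Defs
  imports "HOL-Analysis.Analysis"
begin

section \<open>Smooth functions on subsets of Euclidean space\<close>

text \<open>The model space of dimension \<open>n\<close> is the library's \<^const>\<open>Euclidean_space\<close>, i.e. the
  functions \<open>nat \<Rightarrow> real\<close> vanishing at all indices \<open>\<ge> n\<close>. Its dimension is a natural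
  number, so dimension zero is included.\<close>

definition partial_deriv :: "nat \<Rightarrow> ((nat \<Rightarrow> real) \<Rightarrow> real) \<Rightarrow> (nat \<Rightarrow> real) \<Rightarrow> real" where
  "partial_deriv i f = (\<lambda>y. deriv (\<lambda>t. f (y(i := t))) (y i))"

primrec Ck_on :: "nat \<Rightarrow> (nat \<Rightarrow> real) set \<Rightarrow> nat \<Rightarrow> ((nat \<Rightarrow> real) \<Rightarrow> real) \<Rightarrow> bool" where
  "Ck_on n W 0 f \<longleftrightarrow> continuous_map (subtopology (Euclidean_space n) W) euclideanreal f"
| "Ck_on n W (Suc k) f \<longleftrightarrow>
     continuous_map (subtopology (Euclidean_space n) W) euclideanreal f \<and>
     (\<forall>i<n. (\<forall>y\<in>W. (\<lambda>t. f (y(i := t))) field_differentiable (at (y i))) \<and>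
            Ck_on n W k (partial_deriv i f))"

text \<open>A function on an arbitrary subset \<open>S\<close> is smooth if it is locally the restriction of a
  smooth function on an open subset of Euclidean space; this is what smoothness up to the boundary
  means in the models with corners.\<close>

definition smooth_in :: "nat \<Rightarrow> (nat \<Rightarrow> real) set \<Rightarrow> ((nat \<Rightarrow> real) \<Rightarrow> real) \<Rightarrow> bool" where
  "smooth_in n S f \<longleftrightarrow>
     (\<forall>y\<in>S. \<exists>W F. openin (Euclidean_space n) W \<and> y \<in> W \<and> (\<forall>k. Ck_on n W k F) \<and>
                 (\<forall>z\<in>S \<inter> W. F z = f z))"


section \<open>Manifolds with corners\<close>

definition corner_model :: "nat \<Rightarrow> nat \<Rightarrow> (nat \<Rightarrow> real) topology" where
  "corner_model n k = subtopology (Euclidean_space n) {y. \<forall>i<k. 0 \<le> y i}"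

text \<open>A chart is a triple \<open>(k, U, \<phi>)\<close>: its domain \<open>U\<close> and a map \<open>\<phi>\<close> to the model
  $[0,\infty)^k\times\mathbb R^{n-k}$; the values of \<open>\<phi>\<close> outside \<open>U\<close> are irrelevant.\<close>

type_synonym 'a chart = "nat \<times> 'a set \<times> ('a \<Rightarrow> nat \<Rightarrow> real)"

record 'a manifold =
  topo :: "'a topology"
  mdim :: nat
  charts :: "'a chart set"

definition points :: "'a manifold \<Rightarrow> 'a set" where
  "points M = topspace (topo M)"

definition is_chart :: "'a topology \<Rightarrow> nat \<Rightarrow> 'a chart \<Rightarrow> bool" where
  "is_chart X n = (\<lambda>(k, U, \<phi>). k \<le> n \<and> openin X U \<and>
     (\<exists>W. openin (corner_model n k) W \<and>
          homeomorphic_map (subtopology X U) (subtopology (corner_model n k) W) \<phi>))"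

definition smooth_transition :: "nat \<Rightarrow> 'a chart \<Rightarrow> 'a chart \<Rightarrow> bool" where
  "smooth_transition n = (\<lambda>(k, U, \<phi>) (l, V, \<psi>).
     \<forall>j<n. smooth_in n (\<phi> ` (U \<inter> V)) (\<lambda>y. \<psi> (inv_into U \<phi> y) j))"

definition smooth_atlas :: "'a manifold \<Rightarrow> bool" where
  "smooth_atlas M \<longleftrightarrow>
     Hausdorff_space (topo M) \<and> second_countable (topo M) \<and>
     (\<forall>c\<in>charts M. is_chart (topo M) (mdim M) c) \<and>
     (\<Union>(k, U, \<phi>)\<in>charts M. U) = points M \<and>
     (\<forall>c\<in>charts M. \<forall>c'\<in>charts M. smooth_transition (mdim M) c c')"

text \<open>Functions, vector fields, etc. on a subset of the carrier type are made unique by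
  requiring the value zero off that subset, so that equality is equality as functions on the
  manifold.\<close>

definition smooth_funs :: "'a manifold \<Rightarrow> 'a set \<Rightarrow> ('a \<Rightarrow> real) set" where
  "smooth_funs M U = {f. (\<forall>p. p \<notin> U \<longrightarrow> f p = 0) \<and>
     (\<forall>(k, V, \<phi>)\<in>charts M. smooth_in (mdim M) (\<phi> ` (V \<inter> U)) (\<lambda>y. f (inv_into V \<phi> y)))}"

abbreviation C_inf :: "'a manifold \<Rightarrow> ('a \<Rightarrow> real) set" where
  "C_inf M \<equiv> smooth_funs M (points M)"

text \<open>The tangent space at \<open>p\<close>, as the space of derivations of the algebra of smooth functions
  at \<open>p\<close>. (For a manifold with corners of dimension \<open>n\<close> it has dimension \<open>n\<close> at
  boundary points too.)\<close>

type_synonym 'a derivation = "('a \<Rightarrow> real) \<Rightarrow> real"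

definition tangent :: "'a manifold \<Rightarrow> 'a \<Rightarrow> 'a derivation set" where
  "tangent M p = {D.
     (\<forall>f. f \<notin> C_inf M \<longrightarrow> D f = 0) \<and>
     (\<forall>f\<in>C_inf M. \<forall>g\<in>C_inf M. D (\<lambda>q. f q + g q) = D f + D g) \<and>
     (\<forall>c. \<forall>f\<in>C_inf M. D (\<lambda>q. c * f q) = c * D f) \<and>
     (\<forall>f\<in>C_inf M. \<forall>g\<in>C_inf M. D (\<lambda>q. f q * g q) = f p * D g + g p * D f)}"

definition codim_stratum :: "'a manifold \<Rightarrow> nat \<Rightarrow> 'a set" where
  "codim_stratum M d = {p. \<exists>(k, U, \<phi>)\<in>charts M. p \<in> U \<and> card {i. i < k \<and> \<phi> p i = 0} = d}"

definition faces :: "'a manifold \<Rightarrow> nat \<Rightarrow> 'a set set" where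
  "faces M d =
     (\<lambda>C. topo M closure_of C) ` connected_components_of (subtopology (topo M) (codim_stratum M d))"

abbreviation hyperfaces :: "'a manifold \<Rightarrow> 'a set set" where
  "hyperfaces M \<equiv> faces M 1"

text \<open>A hyperface is embedded if near each of its points it is a single coordinate hyperface.\<close>

definition embedded_hyperface :: "'a manifold \<Rightarrow> 'a set \<Rightarrow> bool" where
  "embedded_hyperface M H \<longleftrightarrow>
     (\<forall>p\<in>H. \<forall>(k, U, \<phi>)\<in>charts M. p \<in> U \<longrightarrow>
        (\<exists>W i. openin (topo M) W \<and> p \<in> W \<and> W \<subseteq> U \<and> i < k \<and> H \<inter> W = {q\<in>W. \<phi> q i = 0}))"

definition defining_function :: "'a manifold \<Rightarrow> 'a set \<Rightarrow> ('a \<Rightarrow> real) \<Rightarrow> bool" where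
  "defining_function M H x \<longleftrightarrow>
     x \<in> C_inf M \<and> (\<forall>p\<in>points M. 0 \<le> x p) \<and> H = {p\<in>points M. x p = 0} \<and>
     (\<forall>p\<in>H. \<exists>D\<in>tangent M p. D x \<noteq> 0)"

definition manifold_with_corners :: "'a manifold \<Rightarrow> bool" where
  "manifold_with_corners M \<longleftrightarrow> smooth_atlas M \<and>
     (\<forall>H\<in>hyperfaces M. embedded_hyperface M H \<and> (\<exists>x. defining_function M H x))"

definition mboundary :: "'a manifold \<Rightarrow> 'a set" where
  "mboundary M = \<Union>(hyperfaces M)"

definition minterior :: "'a manifold \<Rightarrow> 'a set" where
  "minterior M = points M - mboundary M"

definition smooth_manifold :: "'a manifold \<Rightarrow> bool" where
  "smooth_manifold M \<longleftrightarrow> manifold_with_corners M \<and> mboundary M = {}"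

text \<open>\<open>M0\<close> is the interior of \<open>M\<close> as a smooth manifold. The two atlases need not coincide,
  but they have to induce the same smooth functions on every open subset of \<open>M0\<close>, i.e. the
  same smooth structure.\<close>

definition is_interior_of :: "'a manifold \<Rightarrow> 'a manifold \<Rightarrow> bool" where
  "is_interior_of M0 M \<longleftrightarrow>
     topo M0 = subtopology (topo M) (minterior M) \<and> mdim M0 = mdim M \<and>
     (\<forall>U. openin (topo M0) U \<longrightarrow> smooth_funs M0 U = smooth_funs M U)"

text \<open>The differential of the inclusion of \<open>M0\<close> into \<open>M\<close>.\<close>

definition inclusion_diff :: "'a manifold \<Rightarrow> 'a manifold \<Rightarrow> 'a derivation \<Rightarrow> 'a derivation" where
  "inclusion_diff M0 M D =
     (\<lambda>f. if f \<in> C_inf M then D (\<lambda>q. if q \<in> points M0 then f q else 0) else 0)"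


section \<open>Vector fields and structural Lie algebras\<close>

type_synonym 'a vfield = "'a \<Rightarrow> 'a derivation"

definition vector_fields :: "'a manifold \<Rightarrow> 'a vfield set" where
  "vector_fields M = {X.
     (\<forall>p\<in>points M. X p \<in> tangent M p) \<and> (\<forall>p. p \<notin> points M \<longrightarrow> X p = (\<lambda>_. 0)) \<and>
     (\<forall>f\<in>C_inf M. (\<lambda>p. X p f) \<in> C_inf M)}"

definition vf_add :: "'a vfield \<Rightarrow> 'a vfield \<Rightarrow> 'a vfield" where
  "vf_add X Y = (\<lambda>p f. X p f + Y p f)"

definition vf_diff :: "'a vfield \<Rightarrow> 'a vfield \<Rightarrow> 'a vfield" where
  "vf_diff X Y = (\<lambda>p f. X p f - Y p f)"

definition vf_mult :: "('a \<Rightarrow> real) \<Rightarrow> 'a vfield \<Rightarrow> 'a vfield" where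
  "vf_mult h X = (\<lambda>p f. h p * X p f)"

definition lie_bracket :: "'a vfield \<Rightarrow> 'a vfield \<Rightarrow> 'a vfield" where
  "lie_bracket X Y = (\<lambda>p f. X p (\<lambda>q. Y q f) - Y p (\<lambda>q. X q f))"

text \<open>The tangent space of a face \<open>F\<close> at \<open>p\<close> consists of the tangent vectors of \<open>M\<close>
  at \<open>p\<close> that annihilate the smooth functions vanishing on \<open>F\<close>.\<close>

definition tangent_to_faces :: "'a manifold \<Rightarrow> 'a vfield \<Rightarrow> bool" where
  "tangent_to_faces M X \<longleftrightarrow>
     (\<forall>d. \<forall>F\<in>faces M d. \<forall>p\<in>F. \<forall>f\<in>C_inf M. (\<forall>q\<in>F. f q = 0) \<longrightarrow> X p f = 0)"

text \<open>The free module \<open>C_inf M ^ N\<close>, as sequences of smooth functions that vanish from index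
  \<open>N\<close> on.\<close>

definition free_module :: "'a manifold \<Rightarrow> nat \<Rightarrow> (nat \<Rightarrow> 'a \<Rightarrow> real) set" where
  "free_module M N = {F. (\<forall>i<N. F i \<in> C_inf M) \<and> (\<forall>i\<ge>N. F i = (\<lambda>_. 0))}"

definition free_submodule :: "'a manifold \<Rightarrow> nat \<Rightarrow> (nat \<Rightarrow> 'a \<Rightarrow> real) set \<Rightarrow> bool" where
  "free_submodule M N P \<longleftrightarrow> P \<subseteq> free_module M N \<and> (\<lambda>_ _. 0) \<in> P \<and>
     (\<forall>F\<in>P. \<forall>G\<in>P. (\<lambda>i p. F i p + G i p) \<in> P) \<and>
     (\<forall>h\<in>C_inf M. \<forall>F\<in>P. (\<lambda>i p. h p * F i p) \<in> P)"

text \<open>Finitely generated projective: isomorphic to a direct summand \<open>P\<close> of a free module of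
  finite rank.\<close>

definition fg_projective :: "'a manifold \<Rightarrow> 'a vfield set \<Rightarrow> bool" where
  "fg_projective M V \<longleftrightarrow>
     (\<exists>N P Q \<Phi>. free_submodule M N P \<and> free_submodule M N Q \<and>
        P \<inter> Q = {\<lambda>_ _. 0} \<and>
        (\<forall>F\<in>free_module M N. \<exists>G\<in>P. \<exists>H\<in>Q. F = (\<lambda>i p. G i p + H i p)) \<and>
        bij_betw \<Phi> V P \<and>
        (\<forall>X\<in>V. \<forall>Y\<in>V. \<Phi> (vf_add X Y) = (\<lambda>i p. \<Phi> X i p + \<Phi> Y i p)) \<and>
        (\<forall>h\<in>C_inf M. \<forall>X\<in>V. \<Phi> (vf_mult h X) = (\<lambda>i p. h p * \<Phi> X i p)))"

definition structural_lie_algebra :: "'a manifold \<Rightarrow> 'a vfield set \<Rightarrow> bool" where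
  "structural_lie_algebra M V \<longleftrightarrow>
     V \<subseteq> vector_fields M \<and>
     (\<lambda>_ _. 0) \<in> V \<and> (\<forall>X\<in>V. \<forall>Y\<in>V. vf_add X Y \<in> V) \<and> (\<forall>c. \<forall>X\<in>V. vf_mult (\<lambda>_. c) X \<in> V) \<and>
     (\<forall>X\<in>V. \<forall>Y\<in>V. lie_bracket X Y \<in> V) \<and>
     (\<forall>h\<in>C_inf M. \<forall>X\<in>V. vf_mult h X \<in> V) \<and> fg_projective M V \<and>
     (\<forall>X\<in>V. tangent_to_faces M X)"


section \<open>The vector bundle of a structural Lie algebra\<close>

definition vanishing_ideal :: "'a manifold \<Rightarrow> 'a \<Rightarrow> ('a \<Rightarrow> real) set" where
  "vanishing_ideal M x = {f\<in>C_inf M. f x = 0}"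

definition ideal_times :: "'a manifold \<Rightarrow> 'a vfield set \<Rightarrow> 'a \<Rightarrow> 'a vfield set" where
  "ideal_times M V x = {X. \<exists>(m::nat) f Y. (\<forall>i<m. f i \<in> vanishing_ideal M x \<and> Y i \<in> V) \<and>
                                   X = (\<lambda>p h. \<Sum>i<m. f i p * Y i p h)}"

text \<open>The fibre at \<open>x\<close> is the quotient of \<open>V\<close> by \<open>ideal_times M V x\<close>, as a set of cosets;
  \<open>fibre_class M V x X\<close> is the value at \<open>x\<close> of the section of the bundle given by \<open>X\<close>.\<close>

definition fibre_class :: "'a manifold \<Rightarrow> 'a vfield set \<Rightarrow> 'a \<Rightarrow> 'a vfield \<Rightarrow> 'a vfield set" where
  "fibre_class M V x X = {Y\<in>V. vf_diff Y X \<in> ideal_times M V x}"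

definition fibre :: "'a manifold \<Rightarrow> 'a vfield set \<Rightarrow> 'a \<Rightarrow> 'a vfield set set" where
  "fibre M V x = fibre_class M V x ` V"

definition anchor :: "'a \<Rightarrow> 'a vfield set \<Rightarrow> 'a derivation" where
  "anchor x a = (THE D. \<forall>X\<in>a. X x = D)"

text \<open>A metric on the bundle: an inner product on each fibre (the vector space structure being that
  of the quotient), depending smoothly on the base point over all of \<open>M\<close>. As the smooth sections
  of the bundle are precisely those given by the elements of \<open>V\<close>, smoothness of the 2-tensor is
  smoothness of its values on elements of \<open>V\<close>.\<close>

definition bundle_metric ::
    "'a manifold \<Rightarrow> 'a vfield set \<Rightarrow> ('a \<Rightarrow> 'a vfield set \<Rightarrow> 'a vfield set \<Rightarrow> real) \<Rightarrow> bool" where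
  "bundle_metric M V G \<longleftrightarrow>
     (\<forall>x\<in>points M. let cl = fibre_class M V x in
        (\<forall>X\<in>V. \<forall>Y\<in>V. \<forall>Z\<in>V. G x (cl (vf_add X Y)) (cl Z) = G x (cl X) (cl Z) + G x (cl Y) (cl Z)) \<and>
        (\<forall>c. \<forall>X\<in>V. \<forall>Y\<in>V. G x (cl (vf_mult (\<lambda>_. c) X)) (cl Y) = c * G x (cl X) (cl Y)) \<and>
        (\<forall>X\<in>V. \<forall>Y\<in>V. G x (cl X) (cl Y) = G x (cl Y) (cl X)) \<and>
        (\<forall>X\<in>V. cl X \<noteq> cl (\<lambda>_ _. 0) \<longrightarrow> 0 < G x (cl X) (cl X))) \<and>
     (\<forall>X\<in>V. \<forall>Y\<in>V.
        (\<lambda>x. if x \<in> points M then G x (fibre_class M V x X) (fibre_class M V x Y) else 0) \<in> C_inf M)"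

definition lie_structure_at_inf :: "'a manifold \<Rightarrow> 'a manifold \<Rightarrow> 'a vfield set \<Rightarrow> bool" where
  "lie_structure_at_inf M0 M V \<longleftrightarrow>
     smooth_manifold M0 \<and> manifold_with_corners M \<and> compact_space (topo M) \<and>
     is_interior_of M0 M \<and> structural_lie_algebra M V \<and>
     (\<forall>x\<in>points M0. bij_betw (anchor x) (fibre M V x) (inclusion_diff M0 M ` tangent M0 x))"


section \<open>Riemannian metrics and distances\<close>

type_synonym 'a metric_tensor = "'a \<Rightarrow> 'a derivation \<Rightarrow> 'a derivation \<Rightarrow> real"

definition riemannian_metric :: "'a manifold \<Rightarrow> 'a metric_tensor \<Rightarrow> bool" where
  "riemannian_metric M g \<longleftrightarrow>
     (\<forall>p\<in>points M.
        (\<forall>D\<in>tangent M p. \<forall>E\<in>tangent M p. \<forall>F\<in>tangent M p.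
           g p (\<lambda>f. D f + E f) F = g p D F + g p E F) \<and>
        (\<forall>c. \<forall>D\<in>tangent M p. \<forall>E\<in>tangent M p. g p (\<lambda>f. c * D f) E = c * g p D E) \<and>
        (\<forall>D\<in>tangent M p. \<forall>E\<in>tangent M p. g p D E = g p E D) \<and>
        (\<forall>D\<in>tangent M p. D \<noteq> (\<lambda>_. 0) \<longrightarrow> 0 < g p D D)) \<and>
     (\<forall>X\<in>vector_fields M. \<forall>Y\<in>vector_fields M.
        (\<lambda>p. if p \<in> points M then g p (X p) (Y p) else 0) \<in> C_inf M)"

text \<open>The inverse of the anchor over \<open>M0\<close>, i.e. the identification of the tangent bundle of
  \<open>M0\<close> with the restriction of the bundle to \<open>M0\<close>.\<close>

definition tangent_to_fibre ::
    "'a manifold \<Rightarrow> 'a manifold \<Rightarrow> 'a vfield set \<Rightarrow> 'a \<Rightarrow> 'a derivation \<Rightarrow> 'a vfield set" where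
  "tangent_to_fibre M0 M V x D = inv_into (fibre M V x) (anchor x) (inclusion_diff M0 M D)"

definition lie_structure_metric ::
    "'a manifold \<Rightarrow> 'a manifold \<Rightarrow> 'a vfield set \<Rightarrow> 'a metric_tensor \<Rightarrow> bool" where
  "lie_structure_metric M0 M V g \<longleftrightarrow>
     (\<exists>G. bundle_metric M V G \<and>
        (\<forall>x\<in>points M0. \<forall>D\<in>tangent M0 x. \<forall>E\<in>tangent M0 x.
           g x D E = G x (tangent_to_fibre M0 M V x D) (tangent_to_fibre M0 M V x E)))"

text \<open>The distance is the infimum of the lengths of piecewise \<open>C1\<close> curves. It takes values in
  \<^typ>\<open>ennreal\<close>; points in different components have distance \<open>\<infinity>\<close>. Regularity of a
  curve is tested against all smooth functions, with one subdivision \<open>T\<close> of the unit interval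
  for all of them; \<open>\<gamma>\<close> is \<open>C1\<close> up to the end points of each subinterval.\<close>

definition piecewise_C1_curve :: "'a manifold \<Rightarrow> (real \<Rightarrow> 'a) \<Rightarrow> bool" where
  "piecewise_C1_curve M \<gamma> \<longleftrightarrow> pathin (topo M) \<gamma> \<and>
     (\<exists>T. finite T \<and> {0, 1} \<subseteq> T \<and> T \<subseteq> {0..1} \<and>
        (\<forall>a\<in>T. \<forall>b\<in>T. a < b \<and> T \<inter> {a<..<b} = {} \<longrightarrow>
           (\<forall>f\<in>C_inf M. \<exists>f'. continuous_on {a..b} f' \<and>
              (\<forall>t\<in>{a..b}. ((\<lambda>s. f (\<gamma> s)) has_real_derivative f' t) (at t within {a..b})))))"

definition velocity :: "'a manifold \<Rightarrow> (real \<Rightarrow> 'a) \<Rightarrow> real \<Rightarrow> 'a derivation" where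
  "velocity M \<gamma> t = (\<lambda>f. if f \<in> C_inf M then deriv (\<lambda>s. f (\<gamma> s)) t else 0)"

text \<open>The velocity has no meaning at the finitely many points of the subdivision; these do not
  affect the integral.\<close>

definition curve_length :: "'a manifold \<Rightarrow> 'a metric_tensor \<Rightarrow> (real \<Rightarrow> 'a) \<Rightarrow> ennreal" where
  "curve_length M g \<gamma> =
     (\<integral>\<^sup>+t\<in>{0..1}. ennreal (sqrt (g (\<gamma> t) (velocity M \<gamma> t) (velocity M \<gamma> t))) \<partial>lborel)"

definition riemannian_dist :: "'a manifold \<Rightarrow> 'a metric_tensor \<Rightarrow> 'a \<Rightarrow> 'a \<Rightarrow> ennreal" where
  "riemannian_dist M g x y =
     (INF \<gamma>\<in>{\<gamma>. piecewise_C1_curve M \<gamma> \<and> \<gamma> 0 = x \<and> \<gamma> 1 = y}. curve_length M g \<gamma>)"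

end

(* Because the module of vector fields is a direct summand of a free module of rank N, its bundle is
   a subbundle of the trivial bundle of rank N over the compact manifold M. Two metrics on the bundle
   are therefore compared by the maximum of a continuous function on the product of M with the
   unit sphere of R^N, and the anchor transports the comparison to the interior. The comparison of
   distances follows by integrating along curves. *)

theory Submission
  imports Defs
begin

section \<open>The algebra of smooth functions\<close>

text \<open>The interior is in general not compact, so no bound can be found on it directly. The
  comparison takes place on the bundle over all of M, where both metrics stay nondegenerate even at
  boundary points at which the anchor may fail to be injective. The bundle is known only through its
  sections, and a metric only through its values on them. Continuity is therefore extracted from a
  finite generating family of global sections, in which the Gram matrices are smooth on M. The price
  is that the generators are in general linearly dependent at a point, so a quotient of two Gram
  forms can be 0/0; this forces a correction of the denominator that disappears on coordinate
  vectors of actual sections. Only a one-sided estimate is proved; exchanging the two metrics gives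
  the other side.\<close>

lemma eventually_fun_upd_in_openin:
  assumes "openin (Euclidean_space n) W" "y \<in> W" "i < n"
  shows "\<forall>\<^sub>F t in nhds (y i). y(i := t) \<in> W"
proof -
  have y: "y \<in> topspace (Euclidean_space n)"
    using assms openin_subset by blast
  have "continuous_map euclideanreal (Euclidean_space n) (\<lambda>t. y(i := t))"
    using y assms(3)
    by (auto simp: Euclidean_space_def continuous_map_in_subtopology continuous_map_componentwise_UNIV)
  from openin_continuous_map_preimage[OF this assms(1)]
  have "open {t. y(i := t) \<in> W}" by simp
  then show ?thesis
    using assms(2) by (auto simp: eventually_nhds)
qed

text \<open>A partial derivative at y depends only on values near y, and openness of
  \<open>W\<close> keeps short coordinate segments through y inside \<open>W\<close>. This lets the
  sum and product rules, which are known only at points of \<open>W\<close>, be used under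
  \<open>Ck_on\<close>.\<close>

lemma Ck_on_cong:
  assumes W: "openin (Euclidean_space n) W"
  shows "(\<And>y. y \<in> W \<Longrightarrow> f y = g y) \<Longrightarrow> Ck_on n W k f \<Longrightarrow> Ck_on n W k g"
proof (induction k arbitrary: f g)
  case 0
  then show ?case
    by (auto elim!: continuous_map_eq)
next
  case (Suc k)
  have ev: "\<forall>\<^sub>F t in nhds (y i). f (y(i := t)) = g (y(i := t))" if "y \<in> W" "i < n" for y i
    using eventually_fun_upd_in_openin[OF W that] by eventually_elim (rule Suc.prems(1))
  have "(\<lambda>t. g (y(i := t))) field_differentiable at (y i)" if "y \<in> W" "i < n" for y i
  proof -
    have "(\<lambda>t. f (y(i := t))) field_differentiable at (y i)"
      using Suc.prems(2) that by simp
    then show ?thesis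
      unfolding field_differentiable_def using DERIV_cong_ev[OF refl ev[OF that] refl] by blast
  qed
  moreover have "Ck_on n W k (partial_deriv i g)" if "i < n" for i
  proof (rule Suc.IH)
    show "Ck_on n W k (partial_deriv i f)" using Suc.prems(2) that by simp
    show "partial_deriv i f y = partial_deriv i g y" if "y \<in> W" for y
      unfolding partial_deriv_def by (rule deriv_cong_ev) (use ev that \<open>i < n\<close> in auto)
  qed
  ultimately show ?case
    using Suc.prems by (auto elim!: continuous_map_eq)
qed

lemma Ck_on_subset: "Ck_on n W k f \<Longrightarrow> W' \<subseteq> W \<Longrightarrow> Ck_on n W' k f"
  by (induction k arbitrary: f) (auto intro: continuous_map_from_subtopology_mono)

lemma Ck_on_Suc_imp: "Ck_on n W (Suc k) f \<Longrightarrow> Ck_on n W k f"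
  by (induction k arbitrary: f) auto

lemma Ck_on_const: "Ck_on n W k (\<lambda>_. c)"
proof (induction k arbitrary: c)
  case (Suc k)
  have "partial_deriv i (\<lambda>_. c) = (\<lambda>_. 0)" for i
    by (simp add: partial_deriv_def)
  with Suc show ?case by simp
qed simp

lemma Ck_on_add:
  assumes W: "openin (Euclidean_space n) W"
  shows "Ck_on n W k f \<Longrightarrow> Ck_on n W k g \<Longrightarrow> Ck_on n W k (\<lambda>y. f y + g y)"
proof (induction k arbitrary: f g)
  case 0
  then show ?case by (auto intro: continuous_map_add)
next
  case (Suc k)
  have "Ck_on n W k (partial_deriv i (\<lambda>y. f y + g y))" if i: "i < n" for i
  proof (rule Ck_on_cong[OF W])
    show "Ck_on n W k (\<lambda>y. partial_deriv i f y + partial_deriv i g y)"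
      using Suc i by simp
    show "partial_deriv i f y + partial_deriv i g y = partial_deriv i (\<lambda>y. f y + g y) y"
      if "y \<in> W" for y
      using Suc.prems i that by (simp add: partial_deriv_def)
  qed
  with Suc.prems show ?case
    by (auto intro: continuous_map_add derivative_intros)
qed

lemma Ck_on_mult:
  assumes W: "openin (Euclidean_space n) W"
  shows "Ck_on n W k f \<Longrightarrow> Ck_on n W k g \<Longrightarrow> Ck_on n W k (\<lambda>y. f y * g y)"
proof (induction k arbitrary: f g)
  case 0
  then show ?case by (auto intro: continuous_map_real_mult)
next
  case (Suc k)
  have "Ck_on n W k (partial_deriv i (\<lambda>y. f y * g y))" if i: "i < n" for i
  proof (rule Ck_on_cong[OF W])
    show "Ck_on n W k (\<lambda>y. f y * partial_deriv i g y + partial_deriv i f y * g y)"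
      using Suc.prems i Suc.prems[THEN Ck_on_Suc_imp]
      by (intro Ck_on_add[OF W] Suc.IH) auto
    show "f y * partial_deriv i g y + partial_deriv i f y * g y = partial_deriv i (\<lambda>y. f y * g y) y"
      if "y \<in> W" for y
      using Suc.prems i that by (simp add: partial_deriv_def)
  qed
  with Suc.prems show ?case
    by (auto intro: continuous_map_real_mult derivative_intros)
qed

lemma smooth_in_const: "(\<And>y. y \<in> S \<Longrightarrow> f y = c) \<Longrightarrow> S \<subseteq> topspace (Euclidean_space n) \<Longrightarrow> smooth_in n S f"
  unfolding smooth_in_def
  by (intro ballI exI[of _ "topspace (Euclidean_space n)"] exI[of _ "\<lambda>_. c"]) (auto simp: Ck_on_const)

lemma smooth_in_combine:
  assumes f: "smooth_in n S f" and g: "smooth_in n S g"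
    and Ck: "\<And>W k F G. openin (Euclidean_space n) W \<Longrightarrow> Ck_on n W k F \<Longrightarrow> Ck_on n W k G \<Longrightarrow>
      Ck_on n W k (\<lambda>y. op (F y) (G y))"
  shows "smooth_in n S (\<lambda>y. op (f y) (g y))"
  unfolding smooth_in_def
proof
  fix y assume y: "y \<in> S"
  obtain W F where W: "openin (Euclidean_space n) W" "y \<in> W" "\<And>k. Ck_on n W k F" "\<forall>z\<in>S \<inter> W. F z = f z"
    using f y unfolding smooth_in_def by blast
  obtain W' G where W': "openin (Euclidean_space n) W'" "y \<in> W'" "\<And>k. Ck_on n W' k G" "\<forall>z\<in>S \<inter> W'. G z = g z"
    using g y unfolding smooth_in_def by blast
  have "Ck_on n (W \<inter> W') k (\<lambda>y. op (F y) (G y))" for k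
    using W W' by (intro Ck) (auto intro: Ck_on_subset)
  then show "\<exists>W F. openin (Euclidean_space n) W \<and> y \<in> W \<and> (\<forall>k. Ck_on n W k F) \<and>
      (\<forall>z\<in>S \<inter> W. F z = op (f z) (g z))"
    using W W' by (intro exI[of _ "W \<inter> W'"] exI[of _ "\<lambda>y. op (F y) (G y)"]) auto
qed

lemmas smooth_in_add = smooth_in_combine[where op = "(+)", OF _ _ Ck_on_add]
lemmas smooth_in_mult = smooth_in_combine[where op = "(*)", OF _ _ Ck_on_mult]

section \<open>Global smooth functions: ring operations, constants, continuity\<close>

lemma C_inf_add:
  assumes "f \<in> C_inf M" "g \<in> C_inf M"
  shows "(\<lambda>p. f p + g p) \<in> C_inf M"
  using assms unfolding smooth_funs_def by (fastforce intro: smooth_in_add)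

lemma C_inf_mult:
  assumes "f \<in> C_inf M" "g \<in> C_inf M"
  shows "(\<lambda>p. f p * g p) \<in> C_inf M"
  using assms unfolding smooth_funs_def by (fastforce intro: smooth_in_mult)

lemma C_inf_off_points:
  "f \<in> C_inf M \<Longrightarrow> p \<notin> points M \<Longrightarrow> f p = 0"
  by (simp add: smooth_funs_def)

lemma chart_properties:
  assumes "smooth_atlas M" "(k, U, \<phi>) \<in> charts M"
  shows "openin (topo M) U" "inj_on \<phi> U"
    "continuous_map (subtopology (topo M) U) (Euclidean_space (mdim M)) \<phi>"
proof -
  obtain W where W: "openin (topo M) U"
    "homeomorphic_map (subtopology (topo M) U) (subtopology (corner_model (mdim M) k) W) \<phi>"
    using assms unfolding smooth_atlas_def is_chart_def by fast
  show U: "openin (topo M) U" by fact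
  then have "topspace (subtopology (topo M) U) = U"
    using openin_subset by fastforce
  then show "inj_on \<phi> U"
    using W(2) by (metis homeomorphic_imp_injective_map)
  show "continuous_map (subtopology (topo M) U) (Euclidean_space (mdim M)) \<phi>"
    using homeomorphic_imp_continuous_map[OF W(2)]
    by (simp add: corner_model_def continuous_map_in_subtopology)
qed

text \<open>Members of \<open>C_inf M\<close> vanish off \<open>points M\<close>, so a constant
  enters only in this truncated form; the same truncation recurs wherever scalars act on
  modules.\<close>

lemma C_inf_const:
  assumes "smooth_atlas M"
  shows "(\<lambda>p. if p \<in> points M then c else 0) \<in> C_inf M"
proof -
  have "smooth_in (mdim M) (\<phi> ` (U \<inter> points M)) (\<lambda>y. if inv_into U \<phi> y \<in> points M then c else 0)"
    if ch: "(k, U, \<phi>) \<in> charts M" for k U \<phi>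
  proof (rule smooth_in_const[where c = c])
    have U: "U \<subseteq> points M"
      using chart_properties(1)[OF assms ch] openin_subset by (auto simp: points_def)
    then show "(if inv_into U \<phi> y \<in> points M then c else 0) = c" if "y \<in> \<phi> ` (U \<inter> points M)" for y
      using that inv_into_into[of y \<phi> U] by auto
    show "\<phi> ` (U \<inter> points M) \<subseteq> topspace (Euclidean_space (mdim M))"
      using continuous_map_image_subset_topspace[OF chart_properties(3)[OF assms ch]] U
      by (auto simp: points_def)
  qed
  then show ?thesis
    unfolding smooth_funs_def by auto
qed

lemma C_inf_cmult:
  assumes "smooth_atlas M" "f \<in> C_inf M"
  shows "(\<lambda>p. c * f p) \<in> C_inf M"
proof -
  have "(\<lambda>p. c * f p) = (\<lambda>p. (if p \<in> points M then c else 0) * f p)"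
    using C_inf_off_points[OF assms(2)] by auto
  then show ?thesis
    using C_inf_mult[OF C_inf_const[OF assms(1)] assms(2)] by simp
qed

text \<open>Near each point f agrees with \<open>F \<circ> \<phi>\<close>, where F is a continuous
  local extension of f in the chart \<open>\<phi>\<close>; the pasting lemma glues these
  pieces.\<close>

lemma C_inf_continuous_map:
  assumes at: "smooth_atlas M" and f: "f \<in> C_inf M"
  shows "continuous_map (topo M) euclideanreal f"
proof -
  have "\<exists>B. openin (topo M) B \<and> p \<in> B \<and> continuous_map (subtopology (topo M) B) euclideanreal f"
    if "p \<in> topspace (topo M)" for p
  proof -
    obtain k U \<phi> where ch: "(k, U, \<phi>) \<in> charts M" and p: "p \<in> U"
      using at \<open>p \<in> topspace (topo M)\<close> unfolding smooth_atlas_def points_def by blast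
    note c = chart_properties[OF at ch]
    have sub: "U \<inter> points M = U"
      using openin_subset[OF c(1)] by (auto simp: points_def)
    have "smooth_in (mdim M) (\<phi> ` U) (\<lambda>y. f (inv_into U \<phi> y))"
      using f ch sub unfolding smooth_funs_def by fastforce
    then obtain W F where W: "openin (Euclidean_space (mdim M)) W" "\<phi> p \<in> W"
        "Ck_on (mdim M) W 0 F" "\<forall>z\<in>\<phi> ` U \<inter> W. F z = f (inv_into U \<phi> z)"
      using p unfolding smooth_in_def by blast
    define B where "B = {q \<in> topspace (subtopology (topo M) U). \<phi> q \<in> W}"
    have B: "openin (topo M) B"
      using openin_continuous_map_preimage[OF c(3) W(1)] c(1) unfolding B_def
      by (rule openin_trans_full)
    have BU: "B \<subseteq> U" by (auto simp: B_def)
    have "continuous_map (subtopology (topo M) B) (subtopology (Euclidean_space (mdim M)) W) \<phi>"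
      using continuous_map_from_subtopology_mono[OF c(3) BU]
      by (auto simp: continuous_map_in_subtopology B_def)
    from continuous_map_compose[OF this] W(3)
    have "continuous_map (subtopology (topo M) B) euclideanreal (F \<circ> \<phi>)" by simp
    then have "continuous_map (subtopology (topo M) B) euclideanreal f"
      by (rule continuous_map_eq) (use W(4) c(2) in \<open>auto simp: B_def\<close>)
    moreover have "p \<in> B"
      using W(2) p \<open>p \<in> topspace (topo M)\<close> by (simp add: B_def)
    ultimately show ?thesis using B by blast
  qed
  then obtain B where "\<And>p. p \<in> topspace (topo M) \<Longrightarrow> openin (topo M) (B p) \<and> p \<in> B p \<and>
      continuous_map (subtopology (topo M) (B p)) euclideanreal f"
    by metis
  then show ?thesis
    using pasting_lemma[of "topspace (topo M)" "topo M" B euclideanreal "\<lambda>_. f" f] by blast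
qed

section \<open>Metrics on the bundle of a projective module of vector fields\<close>

text \<open>One fixed presentation of the module as a direct summand of a free module. The number
  \<open>\<Phi> X i x\<close> is read as the i-th coordinate in R^N of the value at x of the section
  X.\<close>

locale projective_vf_module =
  fixes M :: "'a manifold" and V :: "'a vfield set" and N :: nat
    and P Q :: "(nat \<Rightarrow> 'a \<Rightarrow> real) set" and \<Phi> :: "'a vfield \<Rightarrow> nat \<Rightarrow> 'a \<Rightarrow> real"
  assumes atlas: "smooth_atlas M"
    and fields: "V \<subseteq> vector_fields M"
    and zero_in: "(\<lambda>_ _. 0) \<in> V"
    and add_in: "X \<in> V \<Longrightarrow> Y \<in> V \<Longrightarrow> vf_add X Y \<in> V"
    and mult_in: "h \<in> C_inf M \<Longrightarrow> X \<in> V \<Longrightarrow> vf_mult h X \<in> V"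
    and P: "free_submodule M N P" and Q: "free_submodule M N Q"
    and PQ: "P \<inter> Q = {\<lambda>_ _. 0}"
    and decomp: "F \<in> free_module M N \<Longrightarrow> \<exists>G\<in>P. \<exists>H\<in>Q. F = (\<lambda>i p. G i p + H i p)"
    and bij: "bij_betw \<Phi> V P"
    and \<Phi>_add: "X \<in> V \<Longrightarrow> Y \<in> V \<Longrightarrow> \<Phi> (vf_add X Y) = (\<lambda>i p. \<Phi> X i p + \<Phi> Y i p)"
    and \<Phi>_mult: "h \<in> C_inf M \<Longrightarrow> X \<in> V \<Longrightarrow> \<Phi> (vf_mult h X) = (\<lambda>i p. h p * \<Phi> X i p)"

lemma structural_lie_algebra_imp_projective:
  assumes "smooth_atlas M" "structural_lie_algebra M V"
  shows "\<exists>N P Q \<Phi>. projective_vf_module M V N P Q \<Phi>"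
proof -
  obtain N P Q \<Phi> where "free_submodule M N P \<and> free_submodule M N Q \<and>
        P \<inter> Q = {\<lambda>_ _. 0} \<and>
        (\<forall>F\<in>free_module M N. \<exists>G\<in>P. \<exists>H\<in>Q. F = (\<lambda>i p. G i p + H i p)) \<and>
        bij_betw \<Phi> V P \<and>
        (\<forall>X\<in>V. \<forall>Y\<in>V. \<Phi> (vf_add X Y) = (\<lambda>i p. \<Phi> X i p + \<Phi> Y i p)) \<and>
        (\<forall>h\<in>C_inf M. \<forall>X\<in>V. \<Phi> (vf_mult h X) = (\<lambda>i p. h p * \<Phi> X i p))"
    using assms(2) unfolding structural_lie_algebra_def fg_projective_def by blast
  then have "projective_vf_module M V N P Q \<Phi>"
    using assms unfolding structural_lie_algebra_def by unfold_locales simp_all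
  then show ?thesis by blast
qed

lemma free_submodule_sum:
  assumes "free_submodule M N P"
  shows "(\<And>i. i < m \<Longrightarrow> f i \<in> C_inf M \<and> F i \<in> P) \<Longrightarrow> (\<lambda>j p. \<Sum>i<(m::nat). f i p * F i j p) \<in> P"
proof (induction m)
  case 0
  then show ?case using assms by (simp add: free_submodule_def)
next
  case (Suc m)
  have "(\<lambda>j p. \<Sum>i<m. f i p * F i j p) \<in> P" "(\<lambda>j p. f m p * F m j p) \<in> P"
    using Suc.IH Suc.prems assms by (auto simp: free_submodule_def)
  from assms[unfolded free_submodule_def, THEN conjunct2, THEN conjunct2, THEN conjunct1,
      rule_format, OF this]
  show ?case by simp
qed

lemma free_submodule_off_points:
  assumes "free_submodule M N P" "F \<in> P" "p \<notin> points M"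
  shows "F j p = 0"
  using assms C_inf_off_points[of "F j" M p]
  by (cases "j < N") (force simp: free_submodule_def free_module_def)+

context projective_vf_module
begin

section \<open>Coordinates of linear combinations of sections\<close>

lemma coord_in: "X \<in> V \<Longrightarrow> \<Phi> X \<in> P"
  using bij by (auto simp: bij_betw_def)

lemma coord_smooth: "X \<in> V \<Longrightarrow> i < N \<Longrightarrow> \<Phi> X i \<in> C_inf M"
  using subsetD[OF P[unfolded free_submodule_def, THEN conjunct1] coord_in]
  by (simp add: free_module_def)

lemma coord_zero: "\<Phi> (\<lambda>_ _. 0) j p = 0"
  using \<Phi>_add[OF zero_in zero_in] by (simp add: vf_add_def fun_eq_iff)

lemma off_points: "X \<in> V \<Longrightarrow> p \<notin> points M \<Longrightarrow> X p h = 0"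
  using fields by (auto simp: vector_fields_def)

lemma lin_comb:
  "(\<And>i. i < m \<Longrightarrow> f i \<in> C_inf M \<and> Y i \<in> V) \<Longrightarrow>
    (\<lambda>p h. \<Sum>i<(m::nat). f i p * Y i p h) \<in> V \<and>
    \<Phi> (\<lambda>p h. \<Sum>i<m. f i p * Y i p h) = (\<lambda>j p. \<Sum>i<m. f i p * \<Phi> (Y i) j p)"
proof (induction m)
  case 0
  then show ?case by (simp add: zero_in coord_zero fun_eq_iff)
next
  case (Suc m)
  define S where "S = (\<lambda>p h. \<Sum>i<m. f i p * Y i p h)"
  have S: "S \<in> V" "\<Phi> S = (\<lambda>j p. \<Sum>i<m. f i p * \<Phi> (Y i) j p)"
    using Suc unfolding S_def by auto
  have eq: "(\<lambda>p h. \<Sum>i<Suc m. f i p * Y i p h) = vf_add S (vf_mult (f m) (Y m))"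
    by (simp add: vf_add_def vf_mult_def S_def fun_eq_iff)
  show ?case
    unfolding eq using S Suc.prems by (simp add: add_in mult_in \<Phi>_add \<Phi>_mult)
qed

text \<open>Vector fields in \<open>V\<close> vanish off \<open>points M\<close>, so truncating the
  constant coefficients to smooth functions does not change the combination.\<close>

lemma const_comb:
  assumes "\<And>i. i < m \<Longrightarrow> Y i \<in> V"
  shows "(\<lambda>p h. \<Sum>i<(m::nat). c i * Y i p h) \<in> V"
    and "x \<in> points M \<Longrightarrow> \<Phi> (\<lambda>p h. \<Sum>i<m. c i * Y i p h) j x = (\<Sum>i<m. c i * \<Phi> (Y i) j x)"
proof -
  have eq: "(\<lambda>p h. \<Sum>i<m. c i * Y i p h) = (\<lambda>p h. \<Sum>i<m. (if p \<in> points M then c i else 0) * Y i p h)"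
    using assms by (auto simp: fun_eq_iff off_points intro!: sum.cong)
  note lc = lin_comb[of m "\<lambda>i p. if p \<in> points M then c i else 0" Y]
  show "(\<lambda>p h. \<Sum>i<m. c i * Y i p h) \<in> V"
    unfolding eq using lc assms C_inf_const[OF atlas] by blast
  show "\<Phi> (\<lambda>p h. \<Sum>i<m. c i * Y i p h) j x = (\<Sum>i<m. c i * \<Phi> (Y i) j x)" if "x \<in> points M"
    unfolding eq using lc assms C_inf_const[OF atlas] that by simp
qed

lemma diff_in:
  assumes "X \<in> V" "Y \<in> V"
  shows "vf_diff X Y \<in> V" and "x \<in> points M \<Longrightarrow> \<Phi> (vf_diff X Y) j x = \<Phi> X j x - \<Phi> Y j x"
proof -
  have eq: "vf_diff X Y = (\<lambda>p h. \<Sum>i<(2::nat). (if i = 0 then 1 else -1) * (if i = 0 then X else Y) p h)"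
    by (simp add: vf_diff_def numeral_2_eq_2 fun_eq_iff)
  note c = const_comb[where m = 2 and Y = "\<lambda>i. if i = 0 then X else Y" and c = "\<lambda>i. if i = 0 then 1 else -1"]
  show "vf_diff X Y \<in> V"
    unfolding eq using c(1) assms by simp
  show "\<Phi> (vf_diff X Y) j x = \<Phi> X j x - \<Phi> Y j x" if "x \<in> points M"
    unfolding eq using c(2)[OF _ that, of j] assms by (simp add: numeral_2_eq_2)
qed

text \<open>The generators are the sections whose coordinates are the \<open>P\<close>-components of
  the standard basis. Expanding the coordinates of X in that basis and splitting along
  \<open>P\<close> and \<open>Q\<close>, the \<open>Q\<close>-part must vanish because X has
  coordinates in \<open>P\<close>.\<close>

lemma frame_exists:
  "\<exists>E. (\<forall>i<N. E i \<in> V) \<and> (\<forall>X\<in>V. X = (\<lambda>p h. \<Sum>i<N. \<Phi> X i p * E i p h))"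
proof -
  define u :: "nat \<Rightarrow> nat \<Rightarrow> 'a \<Rightarrow> real"
    where "u i = (\<lambda>j p. if p \<in> points M then (if j = i then 1 else 0) else 0)" for i
  have "u i \<in> free_module M N" if "i < N" for i
    using that C_inf_const[OF atlas, of 0] C_inf_const[OF atlas, of 1]
    by (auto simp: free_module_def u_def)
  then have "\<forall>i. \<exists>G H. i < N \<longrightarrow> G \<in> P \<and> H \<in> Q \<and> u i = (\<lambda>j p. G j p + H j p)"
    using decomp by meson
  then obtain G H where GH: "\<And>i. i < N \<Longrightarrow> G i \<in> P \<and> H i \<in> Q \<and> u i = (\<lambda>j p. G i j p + H i j p)"
    by metis
  define E where "E i = inv_into V \<Phi> (G i)" for i
  have E: "E i \<in> V" "\<Phi> (E i) = G i" if "i < N" for i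
    using GH[OF that] bij unfolding E_def bij_betw_def
    by (auto intro: inv_into_into f_inv_into_f)
  have "X = (\<lambda>p h. \<Sum>i<N. \<Phi> X i p * E i p h)" if X: "X \<in> V" for X
  proof -
    define F where "F = \<Phi> X"
    have FP: "F \<in> P" and Fs: "\<And>i. i < N \<Longrightarrow> F i \<in> C_inf M"
      using coord_in[OF X] coord_smooth[OF X] by (auto simp: F_def)
    define A where "A = (\<lambda>j p. \<Sum>i<N. F i p * G i j p)"
    define B where "B = (\<lambda>j p. \<Sum>i<N. F i p * H i j p)"
    have AP: "A \<in> P" and BQ: "B \<in> Q"
      unfolding A_def B_def using Fs GH by (auto intro!: free_submodule_sum[OF P] free_submodule_sum[OF Q])
    have FAB: "F j p = A j p + B j p" for j p
    proof (cases "p \<in> points M")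
      case True
      have "A j p + B j p = (\<Sum>i<N. F i p * u i j p)"
        using GH by (simp add: A_def B_def distrib_left flip: sum.distrib)
      also have "\<dots> = (if j < N then F j p else 0)"
        using True by (simp add: u_def if_distrib[of "(*) _"] cong: if_cong)
      also have "\<dots> = F j p"
        using FP P by (auto simp: free_submodule_def free_module_def)
      finally show ?thesis by simp
    next
      case False
      then show ?thesis
        using free_submodule_off_points[OF P FP] free_submodule_off_points[OF P AP]
          free_submodule_off_points[OF Q BQ] by simp
    qed
    \<comment> \<open>\<open>B\<close> is the difference of \<open>F\<close> and \<open>A\<close>,
      hence lies in \<open>P\<close> as well as in \<open>Q\<close>. The negative of
      \<open>A\<close> comes from multiplication by the truncated constant -1.\<close>
    have "(\<lambda>j p. (if p \<in> points M then -1 else 0) * A j p) \<in> P"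
      using P AP C_inf_const[OF atlas, of "-1"] by (simp add: free_submodule_def)
    then have "(\<lambda>j p. F j p + (if p \<in> points M then -1 else 0) * A j p) \<in> P"
      using P FP by (simp add: free_submodule_def)
    also have "(\<lambda>j p. F j p + (if p \<in> points M then -1 else 0) * A j p) = B"
      using free_submodule_off_points[OF Q BQ] free_submodule_off_points[OF P AP]
      by (auto simp: FAB fun_eq_iff)
    finally have "B = (\<lambda>_ _. 0)" using BQ PQ by blast
    then have "\<Phi> X = A" using FAB by (simp add: F_def fun_eq_iff)
    also have "A = \<Phi> (\<lambda>p h. \<Sum>i<N. F i p * E i p h)"
      using lin_comb[of N F E] Fs E by (simp add: A_def)
    finally show ?thesis
      using bij X lin_comb[of N F E] Fs E unfolding F_def bij_betw_def inj_on_def by blast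
  qed
  then show ?thesis using E by blast
qed

text \<open>The coefficients of the frame expansion of Z are its own coordinates; if these vanish at
  x, the expansion exhibits Z as a member of the ideal times the module. Hence the coordinates at x
  embed the abstract quotient fibre into R^N.\<close>

lemma ideal_times_iff:
  assumes x: "x \<in> points M"
  shows "Z \<in> ideal_times M V x \<longleftrightarrow> Z \<in> V \<and> (\<forall>j<N. \<Phi> Z j x = 0)"
proof
  assume "Z \<in> ideal_times M V x"
  then obtain m f Y where m: "\<And>i. i < (m::nat) \<Longrightarrow> f i \<in> vanishing_ideal M x \<and> Y i \<in> V"
    and Z: "Z = (\<lambda>p h. \<Sum>i<m. f i p * Y i p h)"
    unfolding ideal_times_def by blast
  show "Z \<in> V \<and> (\<forall>j<N. \<Phi> Z j x = 0)"
    using lin_comb[of m f Y] m unfolding Z vanishing_ideal_def by auto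
next
  assume Z: "Z \<in> V \<and> (\<forall>j<N. \<Phi> Z j x = 0)"
  obtain E where "\<forall>i<N. E i \<in> V" "Z = (\<lambda>p h. \<Sum>i<N. \<Phi> Z i p * E i p h)"
    using frame_exists Z by blast
  then show "Z \<in> ideal_times M V x"
    using Z coord_smooth unfolding ideal_times_def vanishing_ideal_def by blast
qed

section \<open>Fibres and bundle metrics in coordinates\<close>

lemma fibre_class_eq:
  assumes "x \<in> points M" "X \<in> V"
  shows "fibre_class M V x X = {Y \<in> V. \<forall>j<N. \<Phi> Y j x = \<Phi> X j x}"
  using assms diff_in by (auto simp: fibre_class_def ideal_times_iff)

lemma fibre_class_cong:
  assumes "x \<in> points M" "X \<in> V" "Y \<in> V" "\<And>j. j < N \<Longrightarrow> \<Phi> X j x = \<Phi> Y j x"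
  shows "fibre_class M V x X = fibre_class M V x Y"
  using assms by (simp add: fibre_class_eq)

lemma fibre_class_zero_imp:
  assumes "x \<in> points M" "X \<in> V" "fibre_class M V x X = fibre_class M V x (\<lambda>_ _. 0)" "j < N"
  shows "\<Phi> X j x = 0"
  using assms zero_in by (auto simp: fibre_class_eq coord_zero)

lemma bundle_metric_comb:
  assumes G: "bundle_metric M V G" and x: "x \<in> points M" and Z: "Z \<in> V"
    and Y: "\<And>i. i < (m::nat) \<Longrightarrow> Y i \<in> V"
  shows "G x (fibre_class M V x (\<lambda>p h. \<Sum>i<m. c i * Y i p h)) (fibre_class M V x Z) =
    (\<Sum>i<m. c i * G x (fibre_class M V x (Y i)) (fibre_class M V x Z))"
proof -
  have Gc: "G x (fibre_class M V x (vf_mult (\<lambda>_. c) X)) (fibre_class M V x Z) =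
      c * G x (fibre_class M V x X) (fibre_class M V x Z)" if "X \<in> V" for c X
    using G x Z that by (simp add: bundle_metric_def Let_def)
  show ?thesis using Y
  proof (induction m)
    case 0
    then show ?case
      using Gc[OF Z, of 0] Gc[OF zero_in, of 0] by (simp add: vf_mult_def)
  next
    case (Suc m)
    define S where "S = (\<lambda>p h. \<Sum>i<m. c i * Y i p h)"
    have "S \<in> V" unfolding S_def using Suc.prems by (intro const_comb) auto
    moreover have "vf_mult (\<lambda>_. c m) (Y m) \<in> V"
      using const_comb(1)[of 1 "\<lambda>_. Y m" "\<lambda>_. c m"] Suc.prems by (simp add: vf_mult_def)
    ultimately have "G x (fibre_class M V x (vf_add S (vf_mult (\<lambda>_. c m) (Y m)))) (fibre_class M V x Z) =
        G x (fibre_class M V x S) (fibre_class M V x Z) + c m * G x (fibre_class M V x (Y m)) (fibre_class M V x Z)"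
      using G x Z Gc[of "Y m" "c m"] Suc.prems by (simp add: bundle_metric_def Let_def)
    moreover have "vf_add S (vf_mult (\<lambda>_. c m) (Y m)) = (\<lambda>p h. \<Sum>i<Suc m. c i * Y i p h)"
      by (simp add: vf_add_def vf_mult_def S_def)
    ultimately show ?case using Suc by (simp add: S_def)
  qed
qed

lemma bundle_metric_pos:
  assumes "bundle_metric M V G" "x \<in> points M" "X \<in> V"
    and "fibre_class M V x X \<noteq> fibre_class M V x (\<lambda>_ _. 0)"
  shows "0 < G x (fibre_class M V x X) (fibre_class M V x X)"
  using assms unfolding bundle_metric_def Let_def by blast

lemma bundle_metric_nonneg:
  assumes G: "bundle_metric M V G" and x: "x \<in> points M" and X: "X \<in> V"
  shows "0 \<le> G x (fibre_class M V x X) (fibre_class M V x X)"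
proof (cases "fibre_class M V x X = fibre_class M V x (\<lambda>_ _. 0)")
  case True
  \<comment> \<open>The zero section is the empty combination.\<close>
  have "G x (fibre_class M V x (\<lambda>_ _. 0)) (fibre_class M V x X) = 0"
    using bundle_metric_comb[OF G x X, of 0] by simp
  then show ?thesis using True by simp
next
  case False
  then show ?thesis using bundle_metric_pos[OF G x X] by simp
qed

end

text \<open>Vectors of R^N are represented by sequences, and only the first N entries are
  constrained to the sphere. Confining the remaining entries to [-1,1] makes the set compact by
  Tychonoff; the forms to be compared do not see those entries.\<close>

lemma compact_sphere_in_cube:
  "compactin (powertop_real UNIV) ((PiE UNIV (\<lambda>_. {-1..1})) \<inter> {c. (\<Sum>i<(N::nat). (c i)\<^sup>2) = 1})"
proof -
  have "continuous_map (powertop_real UNIV) euclideanreal (\<lambda>c. \<Sum>i<N. (c i)\<^sup>2)"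
    unfolding power2_eq_square
    by (intro continuous_map_sum continuous_map_real_mult continuous_map_product_projection) auto
  from closedin_continuous_map_preimage[OF this, of "{1}"]
  have "closedin (powertop_real UNIV) {c. (\<Sum>i<N. (c i)\<^sup>2) = 1}" by simp
  then show ?thesis
    by (intro compact_Int_closedin) (simp add: compactin_PiE)
qed

text \<open>The frame presents the bundle as a subbundle of the trivial bundle of rank \<open>N\<close>, namely the
  image of a projection. Adding the squared distance to that image makes the Gram form of the
  second metric positive definite on the whole trivial bundle, so that the quotient of the two
  forms is defined on the compact product of the manifold with a sphere.\<close>

lemma (in projective_vf_module) bundle_metrics_comparable:
  assumes cpt: "compact_space (topo M)"
    and G1: "bundle_metric M V G1" and G2: "bundle_metric M V G2"
  shows "\<exists>C>0. \<forall>x\<in>points M. \<forall>X\<in>V. G1 x (fibre_class M V x X) (fibre_class M V x X) \<le>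
    C * G2 x (fibre_class M V x X) (fibre_class M V x X)"
proof -
  obtain E where E: "\<And>i. i < N \<Longrightarrow> E i \<in> V"
    and expand: "\<And>X. X \<in> V \<Longrightarrow> X = (\<lambda>p h. \<Sum>i<N. \<Phi> X i p * E i p h)"
    using frame_exists by blast
  define comb where "comb c = (\<lambda>p h. \<Sum>i<N. c i * E i p h)" for c :: "nat \<Rightarrow> real"
  have combV: "comb c \<in> V" for c
    unfolding comb_def using E by (rule const_comb)
  have comb_coord: "\<Phi> (comb c) j x = (\<Sum>i<N. c i * \<Phi> (E i) j x)" if "x \<in> points M" for c j x
    unfolding comb_def using E that by (rule const_comb)
  define gram :: "('a \<Rightarrow> 'a vfield set \<Rightarrow> 'a vfield set \<Rightarrow> real) \<Rightarrow> nat \<Rightarrow> nat \<Rightarrow> 'a \<Rightarrow> real"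
    where "gram G i j = (\<lambda>x. if x \<in> points M
      then G x (fibre_class M V x (E i)) (fibre_class M V x (E j)) else 0)" for G i j
  define q where "q G x c = (\<Sum>i<N. \<Sum>j<N. c i * (c j * gram G i j x))" for G x c
  \<comment> \<open>The inner sum is the j-th coordinate of \<open>comb c\<close> at x, that is, of
    the projection of c to the fibre; the defect measures how far c is from being fixed by
    it.\<close>
  define defect where "defect x c = (\<Sum>j<N. (c j - (\<Sum>i<N. c i * \<Phi> (E i) j x))\<^sup>2)" for x c
  have q: "q G x c = G x (fibre_class M V x (comb c)) (fibre_class M V x (comb c))"
    if G: "bundle_metric M V G" and x: "x \<in> points M" for G x c
  proof -
    \<comment> \<open>\<open>bundle_metric_comb\<close> expands the first argument only; symmetry
      brings the second one there.\<close>
    have sym: "G x (fibre_class M V x (E i)) (fibre_class M V x (comb c)) =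
        G x (fibre_class M V x (comb c)) (fibre_class M V x (E i))" if "i < N" for i
      using G x E[OF that] combV[of c] by (simp add: bundle_metric_def Let_def)
    have "G x (fibre_class M V x (comb c)) (fibre_class M V x (comb c)) =
        (\<Sum>i<N. c i * G x (fibre_class M V x (comb c)) (fibre_class M V x (E i)))"
      using bundle_metric_comb[OF G x combV E, of N] sym by (simp add: comb_def)
    also have "\<dots> = (\<Sum>i<N. c i * (\<Sum>j<N. c j * gram G j i x))"
      using bundle_metric_comb[OF G x E E, of _ N] x by (simp add: comb_def gram_def)
    also have "\<dots> = q G x c"
      unfolding q_def sum_distrib_left by (subst sum.swap) (simp add: mult_ac)
    finally show ?thesis by simp
  qed
  define K :: "(nat \<Rightarrow> real) set"
    where "K = (PiE UNIV (\<lambda>_. {-1..1})) \<inter> {c. (\<Sum>i<N. (c i)\<^sup>2) = 1}"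
  define T where "T = prod_topology (topo M) (subtopology (powertop_real UNIV) K)"
  have T: "topspace T = points M \<times> K" "compact_space T"
    using cpt compact_sphere_in_cube[of N] unfolding T_def points_def K_def
    by (auto simp: compact_space_prod_topology compact_space_subtopology)
  have cont_f: "continuous_map T euclideanreal (\<lambda>z. f (fst z))" if "f \<in> C_inf M" for f
    using continuous_map_compose[OF continuous_map_fst C_inf_continuous_map[OF atlas that]]
    by (simp add: T_def comp_def)
  have cont_c: "continuous_map T euclideanreal (\<lambda>z. snd z i)" for i
  proof -
    have "continuous_map (subtopology (powertop_real UNIV) K) euclideanreal (\<lambda>c. c i)"
      by (intro continuous_map_from_subtopology continuous_map_product_projection) simp
    from continuous_map_compose[OF continuous_map_snd this] show ?thesis
      by (simp add: T_def comp_def)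
  qed
  have gram_smooth: "gram G i j \<in> C_inf M" if "bundle_metric M V G" "i < N" "j < N" for G i j
    using that E by (simp add: bundle_metric_def gram_def)
  have cont_q: "continuous_map T euclideanreal (\<lambda>z. q G (fst z) (snd z))"
    if "bundle_metric M V G" for G
    unfolding q_def using gram_smooth[OF that]
    by (intro continuous_map_sum continuous_map_real_mult cont_f cont_c) auto
  have cont_d: "continuous_map T euclideanreal (\<lambda>z. defect (fst z) (snd z))"
    unfolding defect_def power2_eq_square using coord_smooth E
    by (intro continuous_map_sum continuous_map_real_mult continuous_map_diff cont_f cont_c) auto
  have q_nonneg: "0 \<le> q G x c" if "bundle_metric M V G" "x \<in> points M" for G x c
    using q[OF that] bundle_metric_nonneg[OF that combV] by simp
  have d_nonneg: "0 \<le> defect x c" for x c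
    by (simp add: defect_def sum_nonneg)
  \<comment> \<open>If both terms vanish, \<open>comb c\<close> has zero class and so zero
    coordinates at x, while zero defect says that these coordinates are c itself. Then c is zero in
    its first N entries and not on the sphere.\<close>
  have pos: "0 < q G2 x c + defect x c" if x: "x \<in> points M" and c: "c \<in> K" for x c
  proof (rule ccontr)
    assume "\<not> 0 < q G2 x c + defect x c"
    then have 0: "q G2 x c = 0" "defect x c = 0"
      using q_nonneg[OF G2 x, of c] d_nonneg[of x c] by linarith+
    have "fibre_class M V x (comb c) = fibre_class M V x (\<lambda>_ _. 0)"
      using bundle_metric_pos[OF G2 x combV[of c]] 0(1) q[OF G2 x, of c] by auto
    then have "\<Phi> (comb c) j x = 0" if "j < N" for j
      using fibre_class_zero_imp x combV that by blast
    then have "c j = 0" if "j < N" for j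
      using 0(2) that comb_coord[OF x] by (simp add: defect_def sum_nonneg_eq_0_iff)
    then show False using c by (simp add: K_def)
  qed
  have "continuous_map T euclideanreal
      (\<lambda>z. q G1 (fst z) (snd z) / (q G2 (fst z) (snd z) + defect (fst z) (snd z)))"
    using pos T(1)
    by (intro continuous_map_real_divide continuous_map_add cont_q cont_d G1 G2) force
  from image_compactin[OF T(2)[unfolded compact_space_def] this] obtain B where
    B: "\<And>z. z \<in> topspace T \<Longrightarrow> q G1 (fst z) (snd z) / (q G2 (fst z) (snd z) + defect (fst z) (snd z)) \<le> B"
    using compact_imp_bounded[THEN bounded_imp_bdd_above] by (fastforce simp: bdd_above_def)
  \<comment> \<open>\<open>B\<close> is merely some upper bound and need not be positive.\<close>
  define C where "C = max 1 B"
  have le: "q G1 x c \<le> C * (q G2 x c + defect x c)" if "x \<in> points M" "c \<in> K" for x c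
    using B[of "(x, c)"] that pos[OF that] T(1)
    by (smt (verit, best) C_def SigmaI fst_conv snd_conv divide_le_eq mult_right_mono)
  have "G1 x (fibre_class M V x X) (fibre_class M V x X) \<le> C * G2 x (fibre_class M V x X) (fibre_class M V x X)"
    if x: "x \<in> points M" and X: "X \<in> V" for x X
  proof -
    define c where "c i = (if i < N then \<Phi> X i x else 0)" for i
    define r where "r = sqrt (\<Sum>i<N. (c i)\<^sup>2)"
    \<comment> \<open>Applying \<open>\<Phi>\<close> to the frame expansion shows that the
      coordinate vector of a section is fixed by the projection, so its defect is zero and the
      correction drops out. Since X occurs on both sides of the expansion, it is applied once by
      congruence.\<close>
    have "\<Phi> X = \<Phi> (\<lambda>p h. \<Sum>i<N. \<Phi> X i p * E i p h)"
      by (rule arg_cong[OF expand[OF X]])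
    also have "\<dots> = (\<lambda>j p. \<Sum>i<N. \<Phi> X i p * \<Phi> (E i) j p)"
      using lin_comb[of N "\<Phi> X" E] coord_smooth[OF X] E by blast
    finally have coord: "\<Phi> X j x = (\<Sum>i<N. \<Phi> X i x * \<Phi> (E i) j x)" for j
      by (rule fun_cong[THEN fun_cong])
    have proj: "(\<Sum>i<N. c i * \<Phi> (E i) j x) = \<Phi> X j x" for j
      by (subst coord) (simp add: c_def)
    have cl: "fibre_class M V x (comb c) = fibre_class M V x X"
      using proj comb_coord[OF x] by (intro fibre_class_cong x X combV) simp
    have d0: "defect x c = 0"
      by (simp add: defect_def proj) (simp add: c_def)
    have q_scale: "q G x (\<lambda>i. s * c i) = s\<^sup>2 * q G x c" for G s
      by (simp add: q_def sum_distrib_left power2_eq_square mult_ac)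
    have "s * c j - (\<Sum>i<N. s * c i * \<Phi> (E i) j x) = s * (c j - (\<Sum>i<N. c i * \<Phi> (E i) j x))" for s j
      by (simp add: sum_distrib_left right_diff_distrib mult_ac)
    then have d_scale: "defect x (\<lambda>i. s * c i) = s\<^sup>2 * defect x c" for s
      by (simp add: defect_def sum_distrib_left power_mult_distrib)
    have "q G1 x c \<le> C * q G2 x c"
    \<comment> \<open>All forms are homogeneous of degree two, so c may be scaled to the sphere
      unless it is zero, when both forms vanish.\<close>
    proof (cases "r = 0")
      case True
      then have "c i = 0" if "i < N" for i
        using that by (simp add: r_def sum_nonneg_eq_0_iff sum_nonneg)
      then show ?thesis by (simp add: q_def)
    next
      case False
      then have r: "r > 0" "r\<^sup>2 = (\<Sum>i<N. (c i)\<^sup>2)"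
        by (auto simp: r_def sum_nonneg order_less_le)
      have "\<bar>inverse r * c i\<bar> \<le> 1" for i
      proof (cases "i < N")
        case True
        then have "(c i)\<^sup>2 \<le> r\<^sup>2"
          unfolding r(2) by (intro member_le_sum) auto
        then have "\<bar>c i\<bar> \<le> r" using r(1) by (simp add: abs_le_square_iff[symmetric])
        then show ?thesis using r(1) by (simp add: abs_mult field_simps)
      qed (simp add: c_def)
      moreover have "(\<Sum>i<N. (inverse r * c i)\<^sup>2) = 1"
        using r(1) unfolding power_mult_distrib sum_distrib_left[symmetric] r(2)[symmetric]
        by (simp add: power_inverse)
      ultimately have "(\<lambda>i. inverse r * c i) \<in> K"
        by (auto simp: K_def abs_le_iff minus_le_iff)
      from le[OF x this] have "(inverse r)\<^sup>2 * q G1 x c \<le> (inverse r)\<^sup>2 * (C * q G2 x c)"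
        by (simp add: q_scale d_scale d0 mult_ac)
      then show ?thesis using r(1) by simp
    qed
    then show ?thesis using q[OF G1 x, of c] q[OF G2 x, of c] cl by simp
  qed
  moreover have "C > 0" by (simp add: C_def)
  ultimately show ?thesis by blast
qed

section \<open>Lengths of curves and distances\<close>

text \<open>The sum and product rules for derivatives along the curve are the derivation axioms at
  its current point.\<close>

lemma velocity_in_tangent:
  assumes at: "smooth_atlas M"
    and diff: "\<And>f. f \<in> C_inf M \<Longrightarrow> (\<lambda>s. f (\<gamma> s)) field_differentiable at t"
  shows "velocity M \<gamma> t \<in> tangent M (\<gamma> t)"
  using diff by (auto simp: velocity_def tangent_def C_inf_add C_inf_mult C_inf_cmult[OF at])

lemma neighbours_in_finite_set:
  fixes T :: "'a :: linorder set"
  assumes "finite T" "l \<in> T" "u \<in> T" "l \<le> t" "t \<le> u" "t \<notin> T"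
  obtains a b where "a \<in> T" "b \<in> T" "a < t" "t < b" "T \<inter> {a<..<b} = {}"
proof
  let ?L = "{s \<in> T. s < t}" and ?U = "{s \<in> T. t < s}"
  have L: "finite ?L" "?L \<noteq> {}" and U: "finite ?U" "?U \<noteq> {}"
    using assms by (auto simp: order_less_le)
  show "Max ?L \<in> T" "Max ?L < t" using Max_in[OF L] by auto
  show "Min ?U \<in> T" "t < Min ?U" using Min_in[OF U] by auto
  show "T \<inter> {Max ?L<..<Min ?U} = {}"
  proof (rule equals0I)
    fix s assume s: "s \<in> T \<inter> {Max ?L<..<Min ?U}"
    then consider "s \<in> ?L" | "s \<in> ?U" using assms(6) by (cases "s < t") (auto simp: not_less order_le_less)
    then show False
      using s Max_ge[OF L(1), of s] Min_le[OF U(1), of s] by cases auto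
  qed
qed

text \<open>One finite subdivision serves all test functions, so the exceptional set is null. Any
  other time is interior to a subinterval, where the derivative within the interval is a two-sided
  one.\<close>

lemma piecewise_C1_curve_velocity_AE:
  assumes at: "smooth_atlas M" and \<gamma>: "piecewise_C1_curve M \<gamma>"
  shows "AE t in lborel. t \<in> {0..1} \<longrightarrow> \<gamma> t \<in> points M \<and> velocity M \<gamma> t \<in> tangent M (\<gamma> t)"
proof -
  obtain T where T: "finite T" "{0, 1} \<subseteq> T"
    and C1: "\<And>a b f. a \<in> T \<Longrightarrow> b \<in> T \<Longrightarrow> a < b \<Longrightarrow> T \<inter> {a<..<b} = {} \<Longrightarrow> f \<in> C_inf M \<Longrightarrow>
      \<exists>f'. \<forall>t\<in>{a..b}. ((\<lambda>s. f (\<gamma> s)) has_real_derivative f' t) (at t within {a..b})"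
    using \<gamma> unfolding piecewise_C1_curve_def by meson
  have "AE t in lborel. t \<notin> T"
    using T(1) by (intro AE_not_in countable_imp_null_set_lborel countable_finite)
  then show ?thesis
  proof eventually_elim
    case (elim t)
    show ?case
    proof
      assume t: "t \<in> {0..1}"
      have "\<gamma> t \<in> points M"
        using \<gamma> t unfolding piecewise_C1_curve_def pathin_def points_def
        by (auto simp: continuous_map_def)
      moreover obtain a b where ab: "a \<in> T" "b \<in> T" "a < t" "t < b" "T \<inter> {a<..<b} = {}"
        using neighbours_in_finite_set[of T 0 1 t] T t elim by auto
      have "(\<lambda>s. f (\<gamma> s)) field_differentiable at t" if "f \<in> C_inf M" for f
        using C1[OF ab(1,2) _ ab(5) that] ab(3,4) at_within_Icc_at[OF ab(3,4)]
        unfolding field_differentiable_def by (metis atLeastAtMost_iff less_imp_le less_trans)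
      ultimately show "\<gamma> t \<in> points M \<and> velocity M \<gamma> t \<in> tangent M (\<gamma> t)"
        using velocity_in_tangent[OF at] by blast
    qed
  qed
qed

text \<open>Scaling the simple functions below the integrand avoids measurability, which
  \<open>nn_integral_cmult\<close> requires.\<close>

lemma nn_integral_cmult_le:
  assumes "c > 0"
  shows "(\<integral>\<^sup>+x. ennreal c * f x \<partial>M) \<le> ennreal c * (\<integral>\<^sup>+x. f x \<partial>M)"
  unfolding nn_integral_def[of _ "\<lambda>x. ennreal c * f x"]
proof (rule SUP_least)
  fix g assume "g \<in> {g. simple_function M g \<and> g \<le> (\<lambda>x. ennreal c * f x)}"
  then have g: "simple_function M g" "\<And>x. g x \<le> ennreal c * f x"
    by (auto simp: le_fun_def)
  have inv: "ennreal (inverse c) * (ennreal c * y) = y" "ennreal c * (ennreal (inverse c) * y) = y" for y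
    using assms by (simp_all flip: mult.assoc ennreal_mult)
  have "ennreal (inverse c) * g x \<le> f x" for x
    using mult_left_mono[OF g(2)[of x], of "ennreal (inverse c)"] by (simp add: inv)
  then have "(\<integral>\<^sup>+x. ennreal (inverse c) * g x \<partial>M) \<le> (\<integral>\<^sup>+x. f x \<partial>M)"
    by (intro nn_integral_mono)
  moreover have "(\<integral>\<^sup>+x. ennreal (inverse c) * g x \<partial>M) = ennreal (inverse c) * (\<integral>\<^sup>+x. g x \<partial>M)"
    using g(1) by (intro nn_integral_cmult) (rule borel_measurable_simple_function)
  ultimately have "ennreal c * (ennreal (inverse c) * integral\<^sup>S M g) \<le> ennreal c * (\<integral>\<^sup>+x. f x \<partial>M)"
    using g(1) by (intro mult_left_mono) (simp_all add: nn_integral_eq_simple_integral)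
  then show "integral\<^sup>S M g \<le> ennreal c * (\<integral>\<^sup>+x. f x \<partial>M)"
    by (simp add: inv)
qed

text \<open>The hypothesis carries the square of c because lengths integrate the square root of the
  metric.\<close>

lemma riemannian_dist_le_mult:
  assumes at: "smooth_atlas M" and c: "c > 0"
    and le: "\<And>p X. p \<in> points M \<Longrightarrow> X \<in> tangent M p \<Longrightarrow> g p X X \<le> c\<^sup>2 * h p X X"
  shows "riemannian_dist M g x y \<le> ennreal c * riemannian_dist M h x y"
proof -
  have len: "curve_length M g \<gamma> \<le> ennreal c * curve_length M h \<gamma>" if \<gamma>: "piecewise_C1_curve M \<gamma>" for \<gamma>
  proof -
    have "curve_length M g \<gamma> \<le> (\<integral>\<^sup>+t. ennreal c *
        (ennreal (sqrt (h (\<gamma> t) (velocity M \<gamma> t) (velocity M \<gamma> t))) * indicator {0..1} t) \<partial>lborel)"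
      unfolding curve_length_def
    proof (rule nn_integral_mono_AE)
      show "AE t in lborel. ennreal (sqrt (g (\<gamma> t) (velocity M \<gamma> t) (velocity M \<gamma> t))) * indicator {0..1} t
          \<le> ennreal c * (ennreal (sqrt (h (\<gamma> t) (velocity M \<gamma> t) (velocity M \<gamma> t))) * indicator {0..1} t)"
        using piecewise_C1_curve_velocity_AE[OF at \<gamma>]
      proof eventually_elim
        case (elim t)
        show ?case
        proof (cases "t \<in> {0..1}")
          case True
          then have "sqrt (g (\<gamma> t) (velocity M \<gamma> t) (velocity M \<gamma> t)) \<le>
              sqrt (c\<^sup>2 * h (\<gamma> t) (velocity M \<gamma> t) (velocity M \<gamma> t))"
            using elim le by (intro real_sqrt_le_mono) auto
          also have "\<dots> = c * sqrt (h (\<gamma> t) (velocity M \<gamma> t) (velocity M \<gamma> t))"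
            using c by (simp add: real_sqrt_mult)
          finally show ?thesis
            using c True by (simp add: ennreal_leI flip: ennreal_mult')
        qed simp
      qed
    qed
    also have "\<dots> \<le> ennreal c * curve_length M h \<gamma>"
      unfolding curve_length_def by (rule nn_integral_cmult_le[OF c])
    finally show ?thesis .
  qed
  have inv: "ennreal (inverse c) * (ennreal c * z) = z" "ennreal c * (ennreal (inverse c) * z) = z" for z
    using c by (simp_all flip: mult.assoc ennreal_mult)
  \<comment> \<open>Dividing by c first leaves a bare infimum on the right, bounded below curve by
    curve; this includes the case that no curve joins the points.\<close>
  have "ennreal (inverse c) * riemannian_dist M g x y \<le> riemannian_dist M h x y"
    unfolding riemannian_dist_def[of _ h]
  proof (rule INF_greatest)
    fix \<gamma> assume \<gamma>: "\<gamma> \<in> {\<gamma>. piecewise_C1_curve M \<gamma> \<and> \<gamma> 0 = x \<and> \<gamma> 1 = y}"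
    then have "riemannian_dist M g x y \<le> curve_length M g \<gamma>"
      unfolding riemannian_dist_def by (rule INF_lower)
    also have "\<dots> \<le> ennreal c * curve_length M h \<gamma>" using \<gamma> len by blast
    finally show "ennreal (inverse c) * riemannian_dist M g x y \<le> curve_length M h \<gamma>"
      using mult_left_mono[of _ _ "ennreal (inverse c)"] by (metis inv(1) zero_le)
  qed
  then show ?thesis
    using mult_left_mono[of _ _ "ennreal c"] by (metis inv(2) zero_le)
qed

section \<open>Comparison of metrics for a Lie structure at infinity\<close>

lemma bundle_metrics_comparable:
  assumes "smooth_atlas M" "structural_lie_algebra M V" "compact_space (topo M)"
    and "bundle_metric M V G1" "bundle_metric M V G2"
  shows "\<exists>C>0. \<forall>x\<in>points M. \<forall>a\<in>fibre M V x. G1 x a a \<le> C * G2 x a a"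
proof -
  obtain N P Q \<Phi> where "projective_vf_module M V N P Q \<Phi>"
    using structural_lie_algebra_imp_projective[OF assms(1,2)] by (elim exE)
  from projective_vf_module.bundle_metrics_comparable[OF this assms(3-5)]
  show ?thesis by (simp add: fibre_def)
qed

text \<open>Over the interior every tangent vector is the anchor of a fibre element, so the bound
  obtained over compact M applies to it with the same constant.\<close>

lemma lie_structure_metrics_comparable:
  assumes L: "lie_structure_at_inf M0 M V"
    and "lie_structure_metric M0 M V g1" "lie_structure_metric M0 M V g2"
  shows "\<exists>C>0. \<forall>p\<in>points M0. \<forall>X\<in>tangent M0 p. g1 p X X \<le> C * g2 p X X"
proof -
  obtain G1 where G1: "bundle_metric M V G1" and g1: "\<forall>x\<in>points M0. \<forall>D\<in>tangent M0 x. \<forall>E\<in>tangent M0 x.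
      g1 x D E = G1 x (tangent_to_fibre M0 M V x D) (tangent_to_fibre M0 M V x E)"
    using assms(2) unfolding lie_structure_metric_def by (elim exE conjE)
  obtain G2 where G2: "bundle_metric M V G2" and g2: "\<forall>x\<in>points M0. \<forall>D\<in>tangent M0 x. \<forall>E\<in>tangent M0 x.
      g2 x D E = G2 x (tangent_to_fibre M0 M V x D) (tangent_to_fibre M0 M V x E)"
    using assms(3) unfolding lie_structure_metric_def by (elim exE conjE)
  have M: "smooth_atlas M" "structural_lie_algebra M V" "compact_space (topo M)"
    using L by (auto simp: lie_structure_at_inf_def manifold_with_corners_def)
  obtain C where C: "C > 0" "\<forall>x\<in>points M. \<forall>a\<in>fibre M V x. G1 x a a \<le> C * G2 x a a"
    using bundle_metrics_comparable[OF M G1 G2] by (elim exE conjE)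
  have sub: "points M0 \<subseteq> points M"
    using L by (auto simp: lie_structure_at_inf_def is_interior_of_def points_def)
  have fibre: "tangent_to_fibre M0 M V x D \<in> fibre M V x" if "x \<in> points M0" "D \<in> tangent M0 x" for x D
  proof -
    have "inclusion_diff M0 M D \<in> anchor x ` fibre M V x"
      using L that unfolding lie_structure_at_inf_def bij_betw_def by blast
    then show ?thesis
      unfolding tangent_to_fibre_def by (rule inv_into_into)
  qed
  have "g1 p X X \<le> C * g2 p X X" if "p \<in> points M0" "X \<in> tangent M0 p" for p X
    using C(2) fibre[OF that] sub that g1 g2 by auto
  with C(1) show ?thesis by blast
qed

lemma riemannian_metric_nonneg:
  assumes g: "riemannian_metric M g" and p: "p \<in> points M" and D: "D \<in> tangent M p"
  shows "0 \<le> g p D D"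
proof (cases "D = (\<lambda>_. 0)")
  case True
  have "\<forall>c. \<forall>D\<in>tangent M p. \<forall>E\<in>tangent M p. g p (\<lambda>f. c * D f) E = c * g p D E"
    using g p unfolding riemannian_metric_def by simp
  from this[rule_format, OF D D, of 0] show ?thesis using True by simp
next
  case False
  have "\<forall>D\<in>tangent M p. D \<noteq> (\<lambda>_. 0) \<longrightarrow> 0 < g p D D"
    using g p unfolding riemannian_metric_def by simp
  then show ?thesis using D False less_imp_le by blast
qed

theorem corollary2p6:
  fixes M0 M :: "'a manifold" and V :: "'a vfield set" and g1 g2 :: "'a metric_tensor"
  assumes "lie_structure_at_inf M0 M V"
    and "riemannian_metric M0 g1" and "riemannian_metric M0 g2"
    and "lie_structure_metric M0 M V g1" and "lie_structure_metric M0 M V g2"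
  shows "\<exists>C::real. C > 0 \<and>
    (\<forall>p\<in>points M0. \<forall>X\<in>tangent M0 p.
       inverse C * g2 p X X \<le> g1 p X X \<and> g1 p X X \<le> C * g2 p X X) \<and>
    (\<forall>x\<in>points M0. \<forall>y\<in>points M0.
       ennreal (inverse C) * riemannian_dist M0 g2 x y \<le> riemannian_dist M0 g1 x y \<and>
       riemannian_dist M0 g1 x y \<le> ennreal C * riemannian_dist M0 g2 x y)"
proof -
  have at: "smooth_atlas M0"
    using assms(1) by (auto simp: lie_structure_at_inf_def smooth_manifold_def manifold_with_corners_def)
  obtain A where A: "A > 0" "\<forall>p\<in>points M0. \<forall>X\<in>tangent M0 p. g1 p X X \<le> A * g2 p X X"
    using lie_structure_metrics_comparable[OF assms(1,4,5)] by (elim exE conjE)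
  obtain B where B: "B > 0" "\<forall>p\<in>points M0. \<forall>X\<in>tangent M0 p. g2 p X X \<le> B * g1 p X X"
    using lie_structure_metrics_comparable[OF assms(1,5,4)] by (elim exE conjE)
  \<comment> \<open>One constant for both directions and for both metrics and distances. Being at
    least 1 gives \<open>C \<le> C\<^sup>2\<close>, and the bound with the square yields the factor
    \<open>C\<close> for distances. Enlarging a constant relies on the metrics being
    nonnegative.\<close>
  define C where "C = max 1 (max A B)"
  have C: "C > 0" "A \<le> C" "B \<le> C"
    by (auto simp: C_def)
  have C2: "C \<le> C\<^sup>2"
    using power_increasing[of 1 2 C] by (simp add: C_def)
  have g1: "g1 p X X \<le> C * g2 p X X" "g1 p X X \<le> C\<^sup>2 * g2 p X X"
    if pX: "p \<in> points M0" "X \<in> tangent M0 p" for p X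
  proof -
    note nonneg = riemannian_metric_nonneg[OF assms(3) pX]
    show *: "g1 p X X \<le> C * g2 p X X"
      using A(2) pX mult_right_mono[OF C(2) nonneg] by fastforce
    show "g1 p X X \<le> C\<^sup>2 * g2 p X X"
      using * mult_right_mono[OF C2 nonneg] by linarith
  qed
  have g2: "g2 p X X \<le> C * g1 p X X" "g2 p X X \<le> C\<^sup>2 * g1 p X X"
    if pX: "p \<in> points M0" "X \<in> tangent M0 p" for p X
  proof -
    note nonneg = riemannian_metric_nonneg[OF assms(2) pX]
    show *: "g2 p X X \<le> C * g1 p X X"
      using B(2) pX mult_right_mono[OF C(3) nonneg] by fastforce
    show "g2 p X X \<le> C\<^sup>2 * g1 p X X"
      using * mult_right_mono[OF C2 nonneg] by linarith
  qed
  have d: "riemannian_dist M0 g1 x y \<le> ennreal C * riemannian_dist M0 g2 x y"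
    "riemannian_dist M0 g2 x y \<le> ennreal C * riemannian_dist M0 g1 x y" for x y
    using g1(2) g2(2) by (auto intro!: riemannian_dist_le_mult[OF at C(1)])
  have inv: "ennreal (inverse C) * (ennreal C * z) = z" for z
    using C(1) by (simp flip: mult.assoc ennreal_mult)
  have "ennreal (inverse C) * riemannian_dist M0 g2 x y \<le> riemannian_dist M0 g1 x y" for x y
    using mult_left_mono[OF d(2), of "ennreal (inverse C)"] by (simp add: inv)
  moreover have "inverse C * g2 p X X \<le> g1 p X X" if "p \<in> points M0" "X \<in> tangent M0 p" for p X
    using g2(1)[OF that] C(1) by (simp add: field_simps)
  ultimately show ?thesis
    using C(1) g1(1) d(1) by blast
qed

end
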